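(* Let $S\subseteq X$, let $x_0\in S$, and let $F:S\to Y$ be radially $C$-convex and radially $C$-continuous with respect to $x_0$. If $x_0$ is a weakly efficient solution to $F$, then $$\forall x\in S\ \exists w^*\in W^*:\quad (w^*\circ F)^{\downarrow}(x_0,x-x_0)\ge 0.$$
   Context: Setting: $X,Y$ are real locally convex Hausdorff spaces; $\mathcal U_Y(0)$ is a $0$-neighborhood base of $Y$ consisting of balanced convex open sets. $Y$ is pre-ordered by a closed convex cone $C\subseteq Y$ with $\operatorname{int}C\ne\emptyset$ and $C\ne Y$. $C^+=\{y^*\in Y^*: y^*(c)\ge 0\ \forall c\in C\}$, and $W^*$ is a fixed weak$^*$-compact base of $C^+$ (it exists because $\operatorname{int}C\neq\emptyset$). $\overline{\mathbb R}=\mathbb R\cup\{\pm\infty\}$, with $\inf\emptyset=+\infty$ and $(\pm\infty)+r=\pm\infty$ for $r\in\mathbb R$. $F:S\to Y$ is identified with the set-valued function on $X$ equal to $\{F(x)\}$ for $x\in S$ and $\emptyset$ for $x\notin S$ (so $\operatorname{dom}F=S$); $w^*\circ F$ is extended to $X$ by $+\infty$ outside $S$. A set-valued function $G:Z\to\mathcal P(Y)$ on a vector space $Z$ is $C$-convex if $tG(z_1)+(1-t)G(z_2)\subseteq G(tz_1+(1-t)z_2)+C$ for all $z_1,z_2\in Z$, $t\in[0,1]$. For $x\in X$ let $F_{x_0,x}:\mathbb R\to\mathcal P(Y)$ be $F_{x_0,x}(t)=F(x_0+t(x-x_0))$ (as a set-valued function) for $0\le t\le1$ and $\emptyset$ elsewhere.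 $F$ is radially $C$-convex w.r.t. $x_0$ if $F_{x_0,x}$ is $C$-convex for all $x\in X$. $F$ is radially $C$-continuous w.r.t. $x_0$ if for all $x\in S$: for every $U\in\mathcal U_Y(0)$ there is $t_U\in(0,1)$ such that $F(x_0+t(x-x_0))\in F(x_0)+C+U$ for all $t\in(0,t_U)$. $x_0$ is a weakly efficient solution to $F$ if $(F(x_0)-\operatorname{int}C)\cap\{F(x):x\in S\}=\emptyset$. Lower Dini derivative: $\varphi^{\downarrow}(x,u)=\liminf_{t\downarrow0}\frac1t\inf\{\rho\in\mathbb R:\varphi(x+tu)\le\varphi(x)+\rho\}$. *)

theory Defs
  imports "HOL-Analysis.Analysis"
begin

section \<open>Real locally convex Hausdorff spaces\<close>

text \<open>
  The third conjunct is the definition of \<^term>\<open>convex V\<close>, which cannot be used inside a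
  class specification.
\<close>

class locally_convex_space = real_vector + topological_ab_group_add + t2_space +
  assumes tendsto_scaleR_locally_convex:
    "((\<lambda>p. fst p *\<^sub>R snd p) \<longlongrightarrow> r *\<^sub>R x) (nhds r \<times>\<^sub>F nhds x)"
  and locally_convex_base_raw:
    "open U \<Longrightarrow> 0 \<in> U \<Longrightarrow>
      \<exists>V. open V \<and> 0 \<in> V \<and>
          (\<forall>x\<in>V. \<forall>y\<in>V. \<forall>u\<ge>0. \<forall>v\<ge>0. u + v = 1 \<longrightarrow> u *\<^sub>R x + v *\<^sub>R y \<in> V) \<and>
          V \<subseteq> U"

lemma locally_convex_base:
  fixes U :: "'a::locally_convex_space set"
  assumes "open U" and "0 \<in> U"
  shows "\<exists>V. open V \<and> 0 \<in> V \<and> convex V \<and> V \<subseteq> U"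
  unfolding convex_def by (rule locally_convex_base_raw[OF assms])

instance real_normed_vector \<subseteq> locally_convex_space
proof
  fix r :: real and x :: 'a
  show "((\<lambda>p. fst p *\<^sub>R snd p) \<longlongrightarrow> r *\<^sub>R x) (nhds r \<times>\<^sub>F nhds x)"
    by (intro tendsto_scaleR filterlim_fst filterlim_snd)
next
  fix U :: "'a set"
  assume "open U" and "0 \<in> U"
  then obtain e where "e > 0" and "ball 0 e \<subseteq> U"
    by (meson open_contains_ball)
  then have "open (ball (0::'a) e) \<and> 0 \<in> ball (0::'a) e \<and> convex (ball (0::'a) e) \<and> ball 0 e \<subseteq> U"
    by simp
  then show "\<exists>V. open V \<and> 0 \<in> V \<and>
      (\<forall>x\<in>V. \<forall>y\<in>V. \<forall>u\<ge>0. \<forall>v\<ge>0. u + v = 1 \<longrightarrow> u *\<^sub>R x + v *\<^sub>R y \<in> V) \<and> V \<subseteq> U"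
    unfolding convex_def by blast
qed

definition balanced :: "'a::real_vector set \<Rightarrow> bool" where
  "balanced U \<longleftrightarrow> (\<forall>r. \<bar>r\<bar> \<le> 1 \<longrightarrow> (\<lambda>u. r *\<^sub>R u) ` U \<subseteq> U)"

definition zero_nbhd_base :: "'a::locally_convex_space set set \<Rightarrow> bool" where
  "zero_nbhd_base \<U> \<longleftrightarrow>
     (\<forall>U\<in>\<U>. open U \<and> 0 \<in> U \<and> convex U \<and> balanced U) \<and>
     (\<forall>V. open V \<and> 0 \<in> V \<longrightarrow> (\<exists>U\<in>\<U>. U \<subseteq> V))"


section \<open>The dual cone and its weak* compact bases\<close>

definition top_dual :: "('a::locally_convex_space \<Rightarrow> real) set" where
  "top_dual = {f. linear f \<and> continuous_on UNIV f}"

definition weak_star :: "('a::locally_convex_space \<Rightarrow> real) topology" where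
  "weak_star = subtopology (product_topology (\<lambda>_. euclideanreal) UNIV) top_dual"

definition dual_cone :: "'a::locally_convex_space set \<Rightarrow> ('a \<Rightarrow> real) set" where
  "dual_cone C = {f \<in> top_dual. \<forall>c\<in>C. 0 \<le> f c}"

text \<open>
  A base of a convex cone \<open>K\<close> is a convex set \<open>W\<close> whose closure does not contain
  \<open>0\<close> and which satisfies \<open>K = {t w | t \<ge> 0, w \<in> W}\<close>. For weak* compact \<open>W\<close> and
  \<open>K \<noteq> {0}\<close>, the variant of the definition that demands a unique representation \<open>t w\<close>
  with \<open>t > 0\<close> of every nonzero element of \<open>K\<close> is a special case. The vector operations
  on functionals are written out pointwise.
\<close>

definition weak_star_compact_base :: "'a::locally_convex_space set \<Rightarrow> ('a \<Rightarrow> real) set \<Rightarrow> bool" where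
  "weak_star_compact_base C W \<longleftrightarrow>
     compactin weak_star W \<and>
     (\<forall>v\<in>W. \<forall>w\<in>W. \<forall>t\<in>{0..1}. (\<lambda>y. t * v y + (1 - t) * w y) \<in> W) \<and>
     (\<lambda>_. 0) \<notin> weak_star closure_of W \<and>
     dual_cone C = {(\<lambda>y. t * w y) | t w. 0 \<le> t \<and> w \<in> W}"


section \<open>Functions on a subset\<close>

text \<open>
  A function \<open>S \<rightarrow> Y\<close> is a total function \<open>F\<close> together with its domain \<open>S\<close>; the values
  of \<open>F\<close> outside of \<open>S\<close> are never used.
\<close>

definition set_valued :: "'x set \<Rightarrow> ('x \<Rightarrow> 'y) \<Rightarrow> 'x \<Rightarrow> 'y set" where
  "set_valued S F x = (if x \<in> S then {F x} else {})"

definition scalarization :: "'x set \<Rightarrow> ('x \<Rightarrow> 'y) \<Rightarrow> ('y \<Rightarrow> real) \<Rightarrow> 'x \<Rightarrow> ereal" where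
  "scalarization S F w x = (if x \<in> S then ereal (w (F x)) else \<infinity>)"

definition C_convex ::
    "'y::real_vector set \<Rightarrow> ('z::real_vector \<Rightarrow> 'y set) \<Rightarrow> bool" where
  "C_convex C G \<longleftrightarrow> (\<forall>z1 z2. \<forall>t\<in>{0..1}.
     (\<lambda>y. t *\<^sub>R y) ` G z1 + (\<lambda>y. (1 - t) *\<^sub>R y) ` G z2
       \<subseteq> G (t *\<^sub>R z1 + (1 - t) *\<^sub>R z2) + C)"

definition radial_restriction ::
    "'x::real_vector set \<Rightarrow> ('x \<Rightarrow> 'y) \<Rightarrow> 'x \<Rightarrow> 'x \<Rightarrow> real \<Rightarrow> 'y set" where
  "radial_restriction S F x0 x t =
     (if 0 \<le> t \<and> t \<le> 1 then set_valued S F (x0 + t *\<^sub>R (x - x0)) else {})"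

definition radially_C_convex ::
    "'y::real_vector set \<Rightarrow> 'x::real_vector set \<Rightarrow> ('x \<Rightarrow> 'y) \<Rightarrow> 'x \<Rightarrow> bool" where
  "radially_C_convex C S F x0 \<longleftrightarrow> (\<forall>x. C_convex C (radial_restriction S F x0 x))"

text \<open>
  The inclusion holds trivially at points outside of \<open>S\<close>. If \<open>F\<close> is radially
  \<open>C\<close>-convex and \<open>x0, x \<in> S\<close>, then all points of the segment lie in \<open>S\<close>.
\<close>

definition radially_C_continuous ::
    "'y::locally_convex_space set set \<Rightarrow> 'y set \<Rightarrow> 'x::real_vector set \<Rightarrow> ('x \<Rightarrow> 'y) \<Rightarrow> 'x \<Rightarrow> bool" where
  "radially_C_continuous \<U> C S F x0 \<longleftrightarrow>
     (\<forall>x\<in>S. \<forall>U\<in>\<U>. \<exists>tU\<in>{0<..<1}. \<forall>t\<in>{0<..<tU}.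
        set_valued S F (x0 + t *\<^sub>R (x - x0)) \<subseteq> {F x0} + C + U)"

definition weakly_efficient ::
    "'y::locally_convex_space set \<Rightarrow> 'x set \<Rightarrow> ('x \<Rightarrow> 'y) \<Rightarrow> 'x \<Rightarrow> bool" where
  "weakly_efficient C S F x0 \<longleftrightarrow> (\<lambda>c. F x0 - c) ` interior C \<inter> F ` S = {}"


section \<open>Lower Dini derivative of extended real-valued functions\<close>

definition lower_dini :: "('x::real_vector \<Rightarrow> ereal) \<Rightarrow> 'x \<Rightarrow> 'x \<Rightarrow> ereal" where
  "lower_dini \<phi> x u =
     Liminf (at_right (0::real))
       (\<lambda>t. ereal (1 / t) * Inf {ereal \<rho> | \<rho>. \<phi> (x + t *\<^sub>R u) \<le> \<phi> x + ereal \<rho>})"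

end

theory Submission
  imports Defs
begin

text \<open>
  Put \<open>f t = F (x0 + t (x - x0))\<close> for \<open>t \<in> [0,1]\<close>. Radial \<open>C\<close>-convexity makes
  \<open>A = {f t - f 0 | t} + C\<close> convex, and weak efficiency says that \<open>A\<close> does not meet
  \<open>- int C\<close>. A single functional therefore separates \<open>A\<close> from \<open>- int C\<close>: it is nonzero, belongs to
  the dual cone, and is nonnegative on \<open>A\<close>. A positive multiple \<open>w\<close> of it belongs to \<open>W\<close>,
  and \<open>w (f t) \<ge> w (f 0)\<close> for all \<open>t \<in> [0,1]\<close>; so every difference quotient of
  \<open>w \<circ> F\<close> along the segment is nonnegative, and so is the lower Dini derivative.

  The separation is obtained as a positive extension theorem (\<open>positive_functional_exists\<close>). Fix \<open>e\<close> in
  the interior of \<open>C\<close>. The cone generated by \<open>A\<close> has \<open>e\<close> as an order unit and does not contain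
  \<open>-e\<close>. A maximal convex cone \<open>Q\<close> that contains it and still omits \<open>-e\<close> satisfies \<open>Q \<union> -Q = Y\<close>,
  so it induces a total preorder, and each \<open>y\<close> cuts the line through \<open>e\<close> at
  exactly one number, which is the value of the functional at \<open>y\<close>. Continuity is then
  automatic, because the functional is nonnegative on a neighbourhood of \<open>e\<close>.
\<close>

section \<open>Positive functionals on ordered vector spaces\<close>

definition order_unit :: "'a::real_vector set \<Rightarrow> 'a \<Rightarrow> bool" where
  "order_unit Q e \<longleftrightarrow> (\<forall>y. \<exists>r>0. r *\<^sub>R e + y \<in> Q)"

lemma order_unit_mono: "order_unit Q e \<Longrightarrow> Q \<subseteq> R \<Longrightarrow> order_unit R e"
  unfolding order_unit_def by blast

lemma order_unit_mem:
  assumes "convex_cone Q" and "order_unit Q e"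
  shows "e \<in> Q"
proof -
  obtain r where "r > 0" "r *\<^sub>R e + 0 \<in> Q"
    using assms(2) unfolding order_unit_def by blast
  then have "(1 / r) *\<^sub>R (r *\<^sub>R e) \<in> Q"
    using assms(1) by (intro convex_cone_scaleR[of _ "1 / r"]) auto
  with \<open>r > 0\<close> show ?thesis by simp
qed

text \<open>
  If neither \<open>y\<close> nor \<open>-y\<close> were in the maximal cone, then adjoining either ray would produce
  \<open>-e\<close>; a positive combination of the two representations of \<open>-e\<close> eliminates \<open>y\<close>.
\<close>

lemma maximal_convex_cone_total:
  fixes e :: "'a::real_vector"
  assumes "convex_cone P" and "- e \<notin> P"
  shows "\<exists>Q. P \<subseteq> Q \<and> convex_cone Q \<and> - e \<notin> Q \<and> (\<forall>y. y \<in> Q \<or> - y \<in> Q)"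
proof -
  let ?K = "{Q. P \<subseteq> Q \<and> convex_cone Q \<and> - e \<notin> Q}"
  have "\<exists>M\<in>?K. \<forall>X\<in>?K. M \<subseteq> X \<longrightarrow> X = M"
  proof (rule subset_Zorn_nonempty)
    show "?K \<noteq> {}" using assms by blast
    fix \<C> assume ne: "\<C> \<noteq> {}" and ch: "subset.chain ?K \<C>"
    have sub: "\<And>Q. Q \<in> \<C> \<Longrightarrow> P \<subseteq> Q \<and> convex_cone Q \<and> - e \<notin> Q"
      using ch unfolding subset.chain_def by blast
    have "x + y \<in> \<Union>\<C>" if xy: "x \<in> \<Union>\<C>" "y \<in> \<Union>\<C>" for x y
    proof -
      obtain X Y where X: "X \<in> \<C>" "x \<in> X" and Y: "Y \<in> \<C>" "y \<in> Y" using xy by blast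
      have "X \<subseteq> Y \<or> Y \<subseteq> X" using ch X Y by (auto simp: subset_chain_def)
      then show ?thesis using X Y sub convex_cone_add by blast
    qed
    moreover have "c *\<^sub>R x \<in> \<Union>\<C>" if "x \<in> \<Union>\<C>" "0 \<le> c" for x and c :: real
      using that sub convex_cone_scaleR by blast
    moreover have "0 \<in> \<Union>\<C>"
      using ne sub unfolding convex_cone_iff by blast
    ultimately have "convex_cone (\<Union>\<C>)"
      unfolding convex_cone_iff by blast
    then show "\<Union>\<C> \<in> ?K" using ne sub by blast
  qed
  then obtain Q where QK: "Q \<in> ?K" and QX: "\<forall>X\<in>?K. Q \<subseteq> X \<longrightarrow> X = Q" by (elim bexE)
  have PQ: "P \<subseteq> Q" and Q: "convex_cone Q" and eQ: "- e \<notin> Q" using QK by auto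
  have max: "X = Q" if "P \<subseteq> X" "convex_cone X" "- e \<notin> X" "Q \<subseteq> X" for X
    using QX that by simp
  have hit: "\<exists>q s. q \<in> Q \<and> s > 0 \<and> - e = q + s *\<^sub>R y" if yQ: "y \<notin> Q" for y
  proof (rule ccontr)
    assume none: "\<nexists>q s. q \<in> Q \<and> s > 0 \<and> - e = q + s *\<^sub>R y"
    let ?X = "{q + s *\<^sub>R y | q s. q \<in> Q \<and> 0 \<le> s}"
    have in_X: "q + s *\<^sub>R y \<in> ?X" if "q \<in> Q" "0 \<le> s" for q s using that by blast
    have zero: "0 \<in> Q" using Q unfolding convex_cone_iff by blast
    have "convex_cone ?X"
      unfolding convex_cone_iff
    proof (intro conjI ballI allI impI)
      show "0 \<in> ?X" using in_X[OF zero, of 0] by simp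
    next
      fix u v assume "u \<in> ?X" "v \<in> ?X"
      then obtain q s q' s' where "u = q + s *\<^sub>R y" "v = q' + s' *\<^sub>R y"
        and "q \<in> Q" "q' \<in> Q" "0 \<le> s" "0 \<le> s'" by blast
      then show "u + v \<in> ?X"
        using in_X[of "q + q'" "s + s'"] convex_cone_add[OF Q] by (simp add: algebra_simps)
    next
      fix u and c :: real assume "u \<in> ?X" "0 \<le> c"
      then obtain q s where "u = q + s *\<^sub>R y" "q \<in> Q" "0 \<le> s" by blast
      then show "c *\<^sub>R u \<in> ?X"
        using in_X[of "c *\<^sub>R q" "c * s"] convex_cone_scaleR[OF Q] \<open>0 \<le> c\<close>
        by (simp add: algebra_simps)
    qed
    moreover have QX: "Q \<subseteq> ?X" using in_X[of _ 0] by auto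
    moreover have "- e \<notin> ?X"
    proof
      assume "- e \<in> ?X"
      then obtain q s where qs: "q \<in> Q" "0 \<le> s" "- e = q + s *\<^sub>R y" by blast
      have "s \<noteq> 0" using qs eQ by auto
      then have "s > 0" using qs by simp
      then show False using none qs by blast
    qed
    ultimately have "?X = Q" using PQ by (intro max) auto
    then show False using in_X[OF zero, of 1] yQ by simp
  qed
  have "y \<in> Q \<or> - y \<in> Q" for y
  proof (rule ccontr)
    assume "\<not> (y \<in> Q \<or> - y \<in> Q)"
    then obtain q s q' s' where q: "q \<in> Q" "s > 0" "- e = q + s *\<^sub>R y"
      and q': "q' \<in> Q" "s' > 0" "- e = q' + s' *\<^sub>R (- y)"
      using hit[of y] hit[of "- y"] by blast
    have "(s + s') *\<^sub>R (- e) = s *\<^sub>R (- e) + s' *\<^sub>R (- e)"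
      by (simp add: algebra_simps)
    also have "\<dots> = s *\<^sub>R (q' + s' *\<^sub>R (- y)) + s' *\<^sub>R (q + s *\<^sub>R y)"
      using q(3) q'(3) by argo
    also have "\<dots> = s *\<^sub>R q' + s' *\<^sub>R q"
      by (simp add: algebra_simps)
    also have "\<dots> \<in> Q"
      using q q' Q by (intro convex_cone_add convex_cone_scaleR) auto
    finally have "(1 / (s + s')) *\<^sub>R ((s + s') *\<^sub>R (- e)) \<in> Q"
      using q q' Q by (intro convex_cone_scaleR[of _ "1 / (s + s')"]) auto
    then show False using q q' eQ by simp
  qed
  with PQ Q eQ show ?thesis by blast
qed

text \<open>
  In the total preorder given by \<open>Q\<close>, the value at \<open>y\<close> is the Dedekind cut formed by the
  multiples of \<open>e\<close> below \<open>y\<close> and above \<open>y\<close>. The cut is required only away from the cut point,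
  since \<open>Q\<close> need not be closed.
\<close>

lemma total_cone_functional:
  fixes e :: "'a::real_vector"
  assumes Q: "convex_cone Q" and eQ: "- e \<notin> Q"
    and total: "\<And>y. y \<in> Q \<or> - y \<in> Q" and unit: "order_unit Q e"
  shows "\<exists>w::'a \<Rightarrow> real. linear w \<and> w e = 1 \<and> (\<forall>y\<in>Q. 0 \<le> w y)"
proof -
  define cut where "cut y r \<longleftrightarrow>
    (\<forall>s<r. y - s *\<^sub>R e \<in> Q) \<and> (\<forall>s>r. s *\<^sub>R e - y \<in> Q)" for y and r :: real
  have add: "\<And>u v. u \<in> Q \<Longrightarrow> v \<in> Q \<Longrightarrow> u + v \<in> Q" using convex_cone_add[OF Q] .
  have scale: "\<And>c u. 0 \<le> c \<Longrightarrow> u \<in> Q \<Longrightarrow> c *\<^sub>R u \<in> Q" using convex_cone_scaleR[OF Q] .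
  have eQ': "e \<in> Q" by (rule order_unit_mem[OF Q unit])
  have neg: "0 \<le> r" if "r *\<^sub>R e \<in> Q" for r
  proof (rule ccontr)
    assume "\<not> 0 \<le> r"
    then have "(1 / (- r)) *\<^sub>R (r *\<^sub>R e) \<in> Q" using that by (intro scale[of "1 / (- r)"]) auto
    then show False using eQ \<open>\<not> 0 \<le> r\<close> by simp
  qed
  have le: "l \<le> s" if "y - l *\<^sub>R e \<in> Q" "s *\<^sub>R e - y \<in> Q" for y l s
    using neg[of "s - l"] add[OF that] by (simp add: algebra_simps)
  have cut_ex: "\<exists>r. cut y r" for y
  proof -
    let ?L = "{s. y - s *\<^sub>R e \<in> Q}"
    obtain a where "a *\<^sub>R e + y \<in> Q" using unit unfolding order_unit_def by blast
    then have ne: "- a \<in> ?L" by (simp add: algebra_simps)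
    obtain b where "b *\<^sub>R e + (- y) \<in> Q" using unit unfolding order_unit_def by blast
    then have "\<And>l. l \<in> ?L \<Longrightarrow> l \<le> b" using le by simp
    then have bdd: "bdd_above ?L" by (rule bdd_aboveI)
    have "y - s *\<^sub>R e \<in> Q" if "s < Sup ?L" for s
    proof -
      obtain l where l: "l \<in> ?L" "s < l" using \<open>s < Sup ?L\<close> less_cSup_iff[OF _ bdd] ne by blast
      have "(y - l *\<^sub>R e) + (l - s) *\<^sub>R e \<in> Q"
        using l eQ' by (intro add scale) auto
      then show ?thesis by (simp add: algebra_simps)
    qed
    moreover have "s *\<^sub>R e - y \<in> Q" if "s > Sup ?L" for s
    proof -
      have "s \<notin> ?L" using cSup_upper[OF _ bdd] that by (meson not_le)
      then show ?thesis using total[of "y - s *\<^sub>R e"] by simp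
    qed
    ultimately show ?thesis unfolding cut_def by blast
  qed
  have cut_le: "r' \<le> r" if "cut y r" "cut y r'" for y r r'
  proof (rule ccontr)
    assume "\<not> r' \<le> r"
    then obtain s where s: "r < s" "s < r'" using dense not_le by blast
    then obtain s' where s': "s < s'" "s' < r'" using dense by blast
    have "s' \<le> s"
      using that s s' by (intro le[of y]) (auto simp: cut_def)
    then show False using s' by simp
  qed
  define w where "w y = (SOME r. cut y r)" for y
  have cut_w: "cut y (w y)" for y unfolding w_def by (rule someI_ex[OF cut_ex])
  have w_eq: "w y = r" if "cut y r" for y r
    using cut_le cut_w that by (meson antisym)
  have w_lower: "y - s *\<^sub>R e \<in> Q" if "s < w y" for y s using cut_w that unfolding cut_def by blast
  have w_upper: "s *\<^sub>R e - y \<in> Q" if "s > w y" for y s using cut_w that unfolding cut_def by blast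
  have w_add: "w (y + z) = w y + w z" for y z
  proof (rule w_eq, unfold cut_def, intro conjI allI impI)
    fix s assume s: "s < w y + w z"
    define d where "d = (w y + w z - s) / 2"
    have "(y - (w y - d) *\<^sub>R e) + (z - (w z - d) *\<^sub>R e) \<in> Q"
      using s by (intro add w_lower) (auto simp: d_def)
    also have "(y - (w y - d) *\<^sub>R e) + (z - (w z - d) *\<^sub>R e)
        = y + z - ((w y - d) + (w z - d)) *\<^sub>R e"
      by (simp only: scaleR_add_left) simp
    also have "(w y - d) + (w z - d) = s" by (simp add: d_def field_simps)
    finally show "y + z - s *\<^sub>R e \<in> Q" .
  next
    fix s assume s: "s > w y + w z"
    define d where "d = (s - w y - w z) / 2"
    have "((w y + d) *\<^sub>R e - y) + ((w z + d) *\<^sub>R e - z) \<in> Q"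
      using s by (intro add w_upper) (auto simp: d_def)
    also have "((w y + d) *\<^sub>R e - y) + ((w z + d) *\<^sub>R e - z)
        = ((w y + d) + (w z + d)) *\<^sub>R e - (y + z)"
      by (simp only: scaleR_add_left) simp
    also have "(w y + d) + (w z + d) = s" by (simp add: d_def field_simps)
    finally show "s *\<^sub>R e - (y + z) \<in> Q" .
  qed
  have w_pos: "w (c *\<^sub>R y) = c * w y" if c: "c > 0" for c y
  proof (rule w_eq, unfold cut_def, intro conjI allI impI)
    fix s assume "s < c * w y"
    then have "c *\<^sub>R (y - (s / c) *\<^sub>R e) \<in> Q"
      using c by (intro scale w_lower) (auto simp: field_simps)
    then show "c *\<^sub>R y - s *\<^sub>R e \<in> Q" using c by (simp add: scaleR_diff_right)
  next
    fix s assume "s > c * w y"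
    then have "c *\<^sub>R ((s / c) *\<^sub>R e - y) \<in> Q"
      using c by (intro scale w_upper) (auto simp: field_simps)
    then show "s *\<^sub>R e - c *\<^sub>R y \<in> Q" using c by (simp add: scaleR_diff_right)
  qed
  have w_zero: "w 0 = 0" using w_add[of 0 0] by simp
  have w_minus: "w (- y) = - w y" for y using w_add[of y "- y"] w_zero by simp
  have "linear w"
  proof (rule linearI)
    show "w (y + z) = w y + w z" for y z by (rule w_add)
    fix c :: real and y
    consider "c > 0" | "c = 0" | "- c > 0" by linarith
    then show "w (c *\<^sub>R y) = c *\<^sub>R w y"
    proof cases
      case 3
      then show ?thesis using w_pos[OF 3, of y] w_minus[of "c *\<^sub>R y"] by simp
    qed (auto simp: w_pos w_zero)
  qed
  moreover have "w e = 1"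
  proof (rule w_eq, unfold cut_def, intro conjI allI impI)
    fix s :: real assume "s < 1"
    then show "e - s *\<^sub>R e \<in> Q" using scale[of "1 - s", OF _ eQ'] by (simp add: algebra_simps)
  next
    fix s :: real assume "s > 1"
    then show "s *\<^sub>R e - e \<in> Q" using scale[of "s - 1", OF _ eQ'] by (simp add: algebra_simps)
  qed
  moreover have "0 \<le> w y" if "y \<in> Q" for y
  proof (rule ccontr)
    assume "\<not> 0 \<le> w y"
    then obtain s where s: "w y < s" "s < 0" using dense not_le by blast
    have "s *\<^sub>R e \<in> Q" using add[OF w_upper[OF s(1)] that] by simp
    then show False using neg s by fastforce
  qed
  ultimately show ?thesis by blast
qed

theorem positive_functional_exists:
  fixes e :: "'a::real_vector"
  assumes "convex_cone P" and "- e \<notin> P" and "order_unit P e"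
  shows "\<exists>w::'a \<Rightarrow> real. linear w \<and> w e = 1 \<and> (\<forall>y\<in>P. 0 \<le> w y)"
proof -
  obtain Q where Q: "P \<subseteq> Q" "convex_cone Q" "- e \<notin> Q" "\<And>y. y \<in> Q \<or> - y \<in> Q"
    using maximal_convex_cone_total[OF assms(1,2)] by blast
  then show ?thesis
    using total_cone_functional[OF Q(2-4) order_unit_mono[OF assms(3) Q(1)]] by blast
qed

section \<open>Interior points in locally convex spaces\<close>

lemma continuous_on_scaleR_lcs:
  fixes g :: "'t::topological_space \<Rightarrow> 'a::locally_convex_space"
  assumes "continuous_on T f" and "continuous_on T g"
  shows "continuous_on T (\<lambda>t. f t *\<^sub>R g t)"
  unfolding continuous_on_def
proof
  fix t assume "t \<in> T"
  then have "(f \<longlongrightarrow> f t) (at t within T)" "(g \<longlongrightarrow> g t) (at t within T)"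
    using assms by (auto simp: continuous_on_def)
  then have "((\<lambda>s. (f s, g s)) \<longlongrightarrow> (f t, g t)) (at t within T)"
    by (rule tendsto_Pair)
  then have "filterlim (\<lambda>s. (f s, g s)) (nhds (f t) \<times>\<^sub>F nhds (g t)) (at t within T)"
    by (simp add: nhds_prod)
  from filterlim_compose[OF tendsto_scaleR_locally_convex this]
  show "((\<lambda>t. f t *\<^sub>R g t) \<longlongrightarrow> f t *\<^sub>R g t) (at t within T)" by simp
qed

lemma interior_cone_scaleR:
  fixes C :: "'a::locally_convex_space set"
  assumes "cone C" and "c > 0" and "y \<in> interior C"
  shows "c *\<^sub>R y \<in> interior C"
proof (rule interiorI)
  let ?V = "(\<lambda>u. (1 / c) *\<^sub>R u) -` interior C"
  show "open ?V"
    by (intro open_vimage open_interior continuous_on_scaleR_lcs continuous_intros)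
  show "c *\<^sub>R y \<in> ?V" using assms by simp
  show "?V \<subseteq> C"
  proof
    fix u assume "u \<in> ?V"
    then have "(1 / c) *\<^sub>R u \<in> C" using interior_subset by auto
    then have "c *\<^sub>R (1 / c) *\<^sub>R u \<in> C"
      using assms(2) by (intro mem_cone[OF assms(1), of _ c]) simp_all
    then show "u \<in> C" using assms by simp
  qed
qed

lemma interior_add_mem:
  fixes C :: "'a::locally_convex_space set"
  assumes "convex_cone C" and "y \<in> interior C" and "c \<in> C"
  shows "y + c \<in> interior C"
proof (rule interiorI)
  let ?V = "(\<lambda>u. u - c) -` interior C"
  show "open ?V" by (intro open_vimage open_interior continuous_intros)
  show "y + c \<in> ?V" using assms by simp
  show "?V \<subseteq> C"
  proof
    fix u assume "u \<in> ?V"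
    then have "(u - c) + c \<in> C" using interior_subset assms by (intro convex_cone_add) auto
    then show "u \<in> C" by simp
  qed
qed

lemma interior_imp_order_unit:
  fixes C :: "'a::locally_convex_space set"
  assumes "cone C" and e: "e \<in> interior C"
  shows "order_unit C e"
  unfolding order_unit_def
proof
  fix y
  let ?R = "(\<lambda>r::real. e + r *\<^sub>R y) -` interior C"
  have "open ?R"
    by (intro open_vimage open_interior continuous_on_scaleR_lcs continuous_intros)
  moreover have "0 \<in> ?R" using e by simp
  ultimately obtain d where d: "d > 0" "ball 0 d \<subseteq> ?R" by (meson open_contains_ball)
  then have "d / 2 \<in> ?R" by (auto simp: subset_iff dist_real_def)
  then have "e + (d / 2) *\<^sub>R y \<in> C" using interior_subset by auto
  then have "(2 / d) *\<^sub>R (e + (d / 2) *\<^sub>R y) \<in> C" using assms d by (intro mem_cone) auto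
  then have "(2 / d) *\<^sub>R e + y \<in> C" using d by (simp add: scaleR_add_right)
  then show "\<exists>r>0. r *\<^sub>R e + y \<in> C" using d by (intro exI[of _ "2 / d"]) auto
qed

text \<open>
  On the symmetric neighbourhood of \<open>0\<close> formed by the \<open>v\<close> with both \<open>e + v\<close> and \<open>e - v\<close> in the
  interior, positivity bounds the functional by \<open>w e = 1\<close>; shrinking this neighbourhood gives
  continuity at every point.
\<close>

lemma positive_functional_continuous:
  fixes w :: "'a::locally_convex_space \<Rightarrow> real"
  assumes lin: "linear w" and e: "e \<in> interior C" and we: "w e = 1"
    and nonneg: "\<And>c. c \<in> C \<Longrightarrow> 0 \<le> w c"
  shows "continuous_on UNIV w"
  unfolding continuous_on_def
proof (intro ballI tendstoI)
  fix y :: 'a and \<epsilon> :: real assume \<epsilon>: "\<epsilon> > 0"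
  let ?g = "\<lambda>z. (2 / \<epsilon>) *\<^sub>R (z - y)"
  let ?V = "(\<lambda>z. e + ?g z) -` interior C \<inter> (\<lambda>z. e - ?g z) -` interior C"
  have "open ?V"
    by (intro open_Int open_vimage open_interior continuous_on_scaleR_lcs continuous_intros)
  moreover have "y \<in> ?V" using e by simp
  moreover have "dist (w z) (w y) < \<epsilon>" if "z \<in> ?V" for z
  proof -
    have "0 \<le> w (e + ?g z)" "0 \<le> w (e - ?g z)"
      using that interior_subset by (auto intro!: nonneg)
    then have "\<bar>(2 / \<epsilon>) * (w z - w y)\<bar> \<le> 1"
      by (simp add: linear_add[OF lin] linear_diff[OF lin] linear_scale[OF lin] we)
    then have "\<bar>w z - w y\<bar> \<le> \<epsilon> / 2" using \<epsilon> by (simp only: abs_le_iff) (auto simp: field_simps)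
    then show ?thesis using \<epsilon> by (simp add: dist_real_def)
  qed
  ultimately show "\<forall>\<^sub>F z in at y within UNIV. dist (w z) (w y) < \<epsilon>"
    unfolding eventually_at_topological by blast
qed

text \<open>
  The cone generated by \<open>A\<close> contains \<open>-e\<close> only if \<open>A\<close> meets \<open>- int C\<close>: a representation
  \<open>-e = \<lambda> a\<close> with \<open>\<lambda> > 0\<close> rescales to \<open>a = -e/\<lambda>\<close>, and for \<open>\<lambda> = 0\<close> one gets
  \<open>e = 0\<close>, so that the point \<open>0 \<in> A\<close> is itself in \<open>- int C\<close>.
\<close>

lemma dual_cone_separation:
  fixes C :: "'a::locally_convex_space set"
  assumes cone: "cone C" and e: "e \<in> interior C"
    and A: "convex A" and CA: "C \<subseteq> A" and disj: "\<And>k. k \<in> interior C \<Longrightarrow> - k \<notin> A"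
  shows "\<exists>w\<in>dual_cone C. w e = 1 \<and> (\<forall>a\<in>A. 0 \<le> w a)"
proof -
  let ?P = "cone hull A"
  have "e \<in> C" using e interior_subset by blast
  then have "0 \<in> C" using mem_cone[OF cone, of e 0] by simp
  then have P: "convex_cone ?P"
    using CA convex_cone_hull[OF A] mem_cone_hull[of _ A] hull_subset[of A cone]
    by (auto simp: convex_cone_def cone_cone_hull conic_def intro: mem_cone)
  have "- e \<notin> ?P"
  proof
    assume "- e \<in> ?P"
    then obtain l a where l: "- e = l *\<^sub>R a" "0 \<le> l" "a \<in> A" by (auto simp: cone_hull_expl)
    show False
    proof (cases "l = 0")
      case True
      then show False using l disj[of 0] e \<open>0 \<in> C\<close> CA by auto
    next
      case False
      have "a = (1 / l) *\<^sub>R (l *\<^sub>R a)" using False by simp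
      also have "\<dots> = - ((1 / l) *\<^sub>R e)" unfolding l(1)[symmetric] by simp
      finally show False
        using disj[OF interior_cone_scaleR[OF cone _ e, of "1 / l"]] l False by simp
    qed
  qed
  moreover have AP: "A \<subseteq> ?P" by (rule hull_subset)
  moreover have "order_unit ?P e"
    using interior_imp_order_unit[OF cone e] CA AP by (auto intro: order_unit_mono)
  ultimately obtain w :: "'a \<Rightarrow> real" where w: "linear w" "w e = 1" "\<And>y. y \<in> ?P \<Longrightarrow> 0 \<le> w y"
    using positive_functional_exists[OF P] by blast
  then have "continuous_on UNIV w"
    using CA AP by (intro positive_functional_continuous[OF _ e]) auto
  then show ?thesis using w CA AP by (auto simp: dual_cone_def top_dual_def)
qed

section \<open>Radial convexity and the lower Dini derivative\<close>

text \<open>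
  The left-hand side of the convexity inclusion is nonempty when both end points lie in the domain,
  so the set-valued form of convexity also forces the intermediate points into the domain.
\<close>

lemma radially_C_convex_segment:
  assumes "radially_C_convex C S F x0"
    and "x0 + s *\<^sub>R (x - x0) \<in> S" and "x0 + t *\<^sub>R (x - x0) \<in> S"
    and "s \<in> {0..1}" and "t \<in> {0..1}" and "\<theta> \<in> {0..1}"
  defines "r \<equiv> \<theta> * s + (1 - \<theta>) * t"
  shows "x0 + r *\<^sub>R (x - x0) \<in> S \<and>
    (\<exists>c\<in>C. \<theta> *\<^sub>R F (x0 + s *\<^sub>R (x - x0)) + (1 - \<theta>) *\<^sub>R F (x0 + t *\<^sub>R (x - x0))
      = F (x0 + r *\<^sub>R (x - x0)) + c)"
proof -
  let ?G = "radial_restriction S F x0 x"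
  have "(\<lambda>y. \<theta> *\<^sub>R y) ` ?G s + (\<lambda>y. (1 - \<theta>) *\<^sub>R y) ` ?G t \<subseteq> ?G r + C"
    using assms unfolding radially_C_convex_def C_convex_def r_def by auto
  moreover have "?G s = {F (x0 + s *\<^sub>R (x - x0))}" "?G t = {F (x0 + t *\<^sub>R (x - x0))}"
    using assms by (auto simp: radial_restriction_def set_valued_def)
  ultimately have "\<theta> *\<^sub>R F (x0 + s *\<^sub>R (x - x0)) + (1 - \<theta>) *\<^sub>R F (x0 + t *\<^sub>R (x - x0)) \<in> ?G r + C"
    by (auto simp: set_plus_def)
  then obtain g c where g: "g \<in> ?G r" "c \<in> C"
    and eq: "\<theta> *\<^sub>R F (x0 + s *\<^sub>R (x - x0)) + (1 - \<theta>) *\<^sub>R F (x0 + t *\<^sub>R (x - x0)) = g + c"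
    by (rule set_plus_elim)
  then show ?thesis
    by (auto simp: radial_restriction_def set_valued_def split: if_splits)
qed

lemma lower_dini_scalarization_nonneg:
  assumes "x0 \<in> S"
    and "\<And>t. t \<in> {0<..<1} \<Longrightarrow> x0 + t *\<^sub>R u \<in> S \<Longrightarrow> w (F x0) \<le> w (F (x0 + t *\<^sub>R u))"
  shows "0 \<le> lower_dini (scalarization S F w) x0 u"
  unfolding lower_dini_def
proof (rule Liminf_bounded, rule eventually_mono)
  show "\<forall>\<^sub>F t in at_right (0::real). t \<in> {0<..<1}" by (rule eventually_at_right_real) simp
  fix t :: real assume t: "t \<in> {0<..<1}"
  have "0 \<le> Inf {ereal \<rho> | \<rho>.
      scalarization S F w (x0 + t *\<^sub>R u) \<le> scalarization S F w x0 + ereal \<rho>}"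
    using assms(1) assms(2)[OF t]
    by (intro Inf_greatest) (auto simp: scalarization_def split: if_splits)
  then show "0 \<le> ereal (1 / t) * Inf {ereal \<rho> | \<rho>.
      scalarization S F w (x0 + t *\<^sub>R u) \<le> scalarization S F w x0 + ereal \<rho>}"
    using t by (intro ereal_0_le_mult) auto
qed

theorem corollary3p7:
  fixes S :: "'x::locally_convex_space set"
    and F :: "'x \<Rightarrow> 'y::locally_convex_space"
    and x0 :: 'x
    and C :: "'y set"
    and \<U> :: "'y set set"
    and W :: "('y \<Rightarrow> real) set"
  assumes "zero_nbhd_base \<U>"
    and "closed C" and "convex C" and "cone C"
    and "interior C \<noteq> {}" and "C \<noteq> UNIV"
    and "weak_star_compact_base C W"
    and "x0 \<in> S"
    and "radially_C_convex C S F x0"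
    and "radially_C_continuous \<U> C S F x0"
    and "weakly_efficient C S F x0"
  shows "\<forall>x\<in>S. \<exists>w\<in>W. 0 \<le> lower_dini (scalarization S F w) x0 (x - x0)"
proof
  fix x assume x: "x \<in> S"
  obtain e where e: "e \<in> interior C" using assms(5) by blast
  have "C \<noteq> {}" using e interior_subset by blast
  then have CC: "convex_cone C"
    using assms(3,4) by (auto simp: convex_cone_def conic_def cone_def)
  define p where "p t = x0 + t *\<^sub>R (x - x0)" for t
  have p01: "p 0 = x0" "p 1 = x" by (simp_all add: p_def)
  note segment = radially_C_convex_segment[OF assms(9), where x = x, folded p_def]
  have pS: "p t \<in> S" if "t \<in> {0..1}" for t
    using segment[of 1 0 t] that x assms(8) p01 by simp
  define A where "A = {F (p t) - F x0 + c | t c. t \<in> {0..1} \<and> c \<in> C}"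
  have in_A: "F (p t) - F x0 + c \<in> A" if "t \<in> {0..1}" "c \<in> C" for t c
    using that unfolding A_def by blast
  have "convex A"
    unfolding convex_alt
  proof (intro ballI allI impI)
    fix a b and \<theta> :: real assume "a \<in> A" "b \<in> A" and \<theta>: "0 \<le> \<theta> \<and> \<theta> \<le> 1"
    then obtain s c t d where a: "a = F (p s) - F x0 + c" "s \<in> {0..1}" "c \<in> C"
      and b: "b = F (p t) - F x0 + d" "t \<in> {0..1}" "d \<in> C" unfolding A_def by blast
    define r where "r = \<theta> * t + (1 - \<theta>) * s"
    obtain k where k: "k \<in> C" "\<theta> *\<^sub>R F (p t) + (1 - \<theta>) *\<^sub>R F (p s) = F (p r) + k"
      using segment[of t s \<theta>] pS a b \<theta> unfolding r_def by auto
    have r: "r \<in> {0..1}"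
      using convexD_alt[OF convex_real_interval(5)[of 0 1] a(2) b(2), of \<theta>] \<theta>
      by (simp add: r_def add.commute)
    have "(1 - \<theta>) *\<^sub>R a + \<theta> *\<^sub>R b
        = (\<theta> *\<^sub>R F (p t) + (1 - \<theta>) *\<^sub>R F (p s)) - F x0 + (\<theta> *\<^sub>R d + (1 - \<theta>) *\<^sub>R c)"
      unfolding a b by (simp add: algebra_simps)
    also have "\<dots> = F (p r) - F x0 + (k + (\<theta> *\<^sub>R d + (1 - \<theta>) *\<^sub>R c))"
      unfolding k by simp
    also have "\<dots> \<in> A"
      using r k a b \<theta> by (intro in_A convex_cone_add[OF CC] convex_cone_scaleR[OF CC]) auto
    finally show "(1 - \<theta>) *\<^sub>R a + \<theta> *\<^sub>R b \<in> A" .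
  qed
  moreover have "C \<subseteq> A" using in_A[of 0] p01 by auto
  moreover have "- k \<notin> A" if k: "k \<in> interior C" for k
  proof
    assume "- k \<in> A"
    then obtain t c where tc: "- k = F (p t) - F x0 + c" "t \<in> {0..1}" "c \<in> C"
      unfolding A_def by blast
    then have "F (p t) = F x0 - (k + c)" by (simp add: algebra_simps)
    moreover have "k + c \<in> interior C" by (rule interior_add_mem[OF CC k tc(3)])
    ultimately show False
      using assms(11) pS[OF tc(2)] unfolding weakly_efficient_def by blast
  qed
  ultimately obtain v where v: "v \<in> dual_cone C" "v e = 1" "\<And>a. a \<in> A \<Longrightarrow> 0 \<le> v a"
    using dual_cone_separation[OF assms(4) e] by blast
  obtain l w where lw: "v = (\<lambda>y. l * w y)" "0 \<le> l" "w \<in> W"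
    using v(1) assms(7) unfolding weak_star_compact_base_def by auto
  have l: "l > 0" using lw v(2) by (cases "l = 0") auto
  have "w (F x0) \<le> w (F (p t))" if t: "t \<in> {0<..<1}" for t
  proof -
    have lin: "linear v" using v(1) by (simp add: dual_cone_def top_dual_def)
    have "0 \<in> C" using CC by (simp add: convex_cone_iff)
    then have "0 \<le> v (F (p t) - F x0)" using v(3)[OF in_A[of t 0]] t by simp
    then have "l * w (F x0) \<le> l * w (F (p t))" using linear_diff[OF lin] lw(1) by simp
    then show ?thesis using l by simp
  qed
  then have "0 \<le> lower_dini (scalarization S F w) x0 (x - x0)"
    using assms(8) by (intro lower_dini_scalarization_nonneg) (auto simp: p_def)
  with lw(3) show "\<exists>w\<in>W. 0 \<le> lower_dini (scalarization S F w) x0 (x - x0)" by blast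
qed

end
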